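(* Any asymptotically exact streaming algorithm for $k$-median with $k\ge2$, respectively for $k$-means with $k\ge3$, uses $\Omega(n)$ memory.
   Context: The input is a stream of points in $\mathbb{R}^d$ (the hardness already holds in dimension $d=2$). The $k$-means (resp. $k$-median) problem on the prefix $P^{(n)}$ of the first $n$ points asks for a set $C$ of $k$ centers minimizing $\sum_{p\in P^{(n)}}\mathrm{dist}(p,C)^2$ (resp. $\sum_{p\in P^{(n)}}\mathrm{dist}(p,C)$), with $\mathrm{dist}(p,C)=\min_{c\in C}\|p-c\|$. An asymptotically exact streaming algorithm is a one-pass algorithm that, on an infinite stream, after every prefix of length $n$ outputs $k$ centers whose cost divided by the optimal cost for that prefix tends to $1$ as $n\to\infty$ with probability at least $1-\delta$ ($\delta<1/2$). The claim is that any such algorithm uses $\Omega(n)$ bits of memory in the worst case. *)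

theory Defs
  imports "HOL-Probability.Probability" "HOL-Library.Landau_Symbols"
begin

section \<open>Clustering the prefixes of a stream\<close>

text \<open>A stream is a function \<open>P\<close> on the naturals; its prefix of length \<open>n\<close> consists of
  \<open>P 0, \<dots>, P (n - 1)\<close>, counted with multiplicity.\<close>

definition kmedian_cost :: "(nat \<Rightarrow> real ^ 'd) \<Rightarrow> nat \<Rightarrow> (real ^ 'd) set \<Rightarrow> real" where
  "kmedian_cost P n C = (\<Sum>i<n. infdist (P i) C)"

definition kmeans_cost :: "(nat \<Rightarrow> real ^ 'd) \<Rightarrow> nat \<Rightarrow> (real ^ 'd) set \<Rightarrow> real" where
  "kmeans_cost P n C = (\<Sum>i<n. (infdist (P i) C)\<^sup>2)"

type_synonym 'd clustering_cost = "(nat \<Rightarrow> real ^ 'd) \<Rightarrow> nat \<Rightarrow> (real ^ 'd) set \<Rightarrow> real"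

definition opt_cost :: "'d::finite clustering_cost \<Rightarrow> nat \<Rightarrow> (nat \<Rightarrow> real ^ 'd) \<Rightarrow> nat \<Rightarrow> real" where
  "opt_cost cost k P n = (INF C\<in>{C. finite C \<and> card C = k}. cost P n C)"

section \<open>Randomized one-pass algorithms with bit memory\<close>

text \<open>All randomness is drawn once, as a seed \<open>\<omega>\<close> from the probability space \<open>coins\<close>. Reading
  the seed and the number of points seen so far is free of charge; only the bit string carried
  from one point to the next counts as memory. This subsumes algorithms that flip fresh coins in
  every step, and makes the lower bound apply to non-uniform algorithms as well.\<close>

record ('r, 'd) streaming_alg =
  coins :: "'r measure"
  init :: "'r \<Rightarrow> bool list"
  step :: "'r \<Rightarrow> nat \<Rightarrow> bool list \<Rightarrow> real ^ 'd \<Rightarrow> bool list"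
  centers :: "'r \<Rightarrow> nat \<Rightarrow> bool list \<Rightarrow> (real ^ 'd) set"

primrec memory_state ::
  "('r, 'd) streaming_alg \<Rightarrow> 'r \<Rightarrow> (nat \<Rightarrow> real ^ 'd) \<Rightarrow> nat \<Rightarrow> bool list" where
  "memory_state A \<omega> P 0 = init A \<omega>"
| "memory_state A \<omega> P (Suc n) = step A \<omega> n (memory_state A \<omega> P n) (P n)"

definition output_centers ::
  "('r, 'd) streaming_alg \<Rightarrow> 'r \<Rightarrow> (nat \<Rightarrow> real ^ 'd) \<Rightarrow> nat \<Rightarrow> (real ^ 'd) set" where
  "output_centers A \<omega> P n = centers A \<omega> n (memory_state A \<omega> P n)"

text \<open>\<open>X\<close> is the set of points that may occur in the stream. The quotient of the costs is
  meaningful only once the optimal cost is positive, i.e. once the stream has shown more than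
  \<open>k\<close> distinct points, so convergence is demanded exactly on the streams where this
  eventually happens.\<close>

definition asymptotically_exact ::
  "'d::finite clustering_cost \<Rightarrow> nat \<Rightarrow> real \<Rightarrow> (real ^ 'd) set \<Rightarrow> ('r, 'd) streaming_alg \<Rightarrow> bool" where
  "asymptotically_exact cost k \<delta> X A \<longleftrightarrow>
     prob_space (coins A) \<and>
     (\<forall>P. range P \<subseteq> X \<longrightarrow>
        (\<forall>\<omega>\<in>space (coins A). \<forall>n.
           finite (output_centers A \<omega> P n) \<and> card (output_centers A \<omega> P n) = k) \<and>
        ((\<forall>\<^sub>F n in sequentially. opt_cost cost k P n > 0) \<longrightarrow>
           measure (coins A)
             {\<omega> \<in> space (coins A).
                (\<lambda>n. cost P n (output_centers A \<omega> P n) / opt_cost cost k P n)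
                  \<longlonglongrightarrow> 1} \<ge> 1 - \<delta>))"

definition integer_points :: "(real ^ 'd) set" where
  "integer_points = {p. \<forall>j. p $ j \<in> \<int>}"

text \<open>With points of unbounded precision, already the first few of them can force any number
  of bits, for the trivial reason that they have to be read. The worst case over prefixes of length
  \<open>n\<close> is therefore taken over points that are described by \<open>O(log n)\<close> bits per coordinate,
  namely integer points with coordinates between \<open>-n\<close> and \<open>n\<close>. A bound over a
  larger class of prefixes is in particular a bound over these.\<close>

definition uses_memory :: "('r, 'd::finite) streaming_alg \<Rightarrow> (nat \<Rightarrow> nat) \<Rightarrow> bool" where
  "uses_memory A s \<longleftrightarrow>
     (\<forall>n P. (\<forall>i<n. P i \<in> integer_points \<and> (\<forall>j. \<bar>P i $ j\<bar> \<le> real n)) \<longrightarrow>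
        (AE \<omega> in coins A. length (memory_state A \<omega> P n) \<le> s n))"

end

theory Submission
  imports Defs
begin

text \<open>The proof is a reduction from the one-way communication problem INDEX. A set \<open>S \<subseteq> {..<m}\<close> is
  written into a prefix of \<open>n = O(m)\<close> integer points on a line, the bit \<open>i \<in> S\<close> shifting the \<open>i\<close>-th
  point by one. The stream continues with finitely many points depending on a query \<open>i\<close> and then
  repeats \<open>k - 1\<close> anchors forever. The optimal cost stays bounded, so centers with cost ratio
  tending to 1 must converge to the anchors, except for one free center, which must become almost
  optimal for the finitely many remaining points; the query is chosen such that this reveals
  whether \<open>i \<in> S\<close>. Hence, for every seed, the memory state after \<open>n\<close> points determines the
  bit \<open>i \<in> S\<close> on all pairs \<open>(S, i)\<close> on which the algorithm succeeds. With \<open>o(m)\<close> bits of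
  memory these are little more than half of the pairs, whereas on average over the seed they are
  at least a fraction \<open>1 - \<delta> > 1 / 2\<close>. As only finitely many streams are involved, no joint
  measurability in seed and stream is needed.\<close>

section \<open>The INDEX problem\<close>

definition agreements :: "'i set \<Rightarrow> 'i set \<Rightarrow> 'i set \<Rightarrow> 'i set" where
  "agreements I S Y = {i\<in>I. i \<in> S \<longleftrightarrow> i \<in> Y}"

lemma sum_power_card_agreements:
  fixes x :: "'a::comm_semiring_1"
  assumes "finite I"
  shows "(\<Sum>S\<in>Pow I. x ^ card (agreements I S Y)) = (1 + x) ^ card I"
proof -
  define f where "f i = (if i \<in> Y then x else 1)" for i
  define g where "g i = (if i \<in> Y then 1 else x)" for i
  have "x ^ card (agreements I S Y) = prod f S * prod g (I - S)" if "S \<in> Pow I" for S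
  proof -
    have fin: "finite S" using that assms finite_subset by auto
    have "agreements I S Y = (S \<inter> Y) \<union> ((I - S) \<inter> - Y)"
      using that by (auto simp: agreements_def)
    then have "card (agreements I S Y) = card (S \<inter> Y) + card ((I - S) \<inter> - Y)"
      using fin assms by (simp only:) (rule card_Un_disjoint, auto)
    then show ?thesis
      using fin assms by (simp add: f_def g_def prod.If_cases power_add)
  qed
  then have "(\<Sum>S\<in>Pow I. x ^ card (agreements I S Y)) = (\<Sum>S\<in>Pow I. prod f S * prod g (I - S))"
    by (rule sum.cong[OF refl])
  also have "\<dots> = (\<Prod>i\<in>I. f i + g i)" using assms by (simp add: prod_add)
  also have "\<dots> = (\<Prod>i\<in>I. 1 + x)" by (intro prod.cong) (auto simp: f_def g_def add.commute)
  finally show ?thesis by simp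
qed

lemma sum_power_card_agreements_decoder_le:
  fixes x :: real and decoder :: "'b \<Rightarrow> 'i set"
  assumes "finite I" "finite B" "msg ` Pow I \<subseteq> B" "0 \<le> x"
  shows "(\<Sum>S\<in>Pow I. x ^ card (agreements I S (decoder (msg S)))) \<le> real (card B) * (1 + x) ^ card I"
proof -
  have "(\<Sum>S\<in>Pow I. x ^ card (agreements I S (decoder (msg S))))
      \<le> (\<Sum>S\<in>Pow I. \<Sum>z\<in>B. x ^ card (agreements I S (decoder z)))"
    using assms
    by (intro sum_mono member_le_sum[of _ B "\<lambda>z. x ^ card (agreements I _ (decoder z))"]) auto
  also have "\<dots> = (\<Sum>z\<in>B. (1 + x) ^ card I)"
    using assms(1) by (subst sum.swap) (simp add: sum_power_card_agreements)
  finally show ?thesis by simp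
qed

lemma one_plus_exp_half_le:
  fixes l :: real
  assumes "0 \<le> l"
  shows "(1 + exp l) / 2 \<le> exp (l / 2 + l\<^sup>2 / 8)"
proof -
  have "ln ((1 + exp l) / 2) \<le> l / 2 + l\<^sup>2 / 8"
    using Hoeffdings_lemma_aux[of l "1/2"] assms by (simp add: field_simps)
  moreover have "(1 + exp l) / 2 = exp (ln ((1 + exp l) / 2))"
    by (simp add: add_pos_pos)
  ultimately show ?thesis by (metis exp_le_cancel_iff)
qed

lemma exp_average_le:
  fixes f :: "'a \<Rightarrow> real"
  assumes "finite A" "A \<noteq> {}"
  shows "exp ((\<Sum>x\<in>A. f x) / card A) \<le> (\<Sum>x\<in>A. exp (f x)) / card A"
proof -
  have "exp (\<Sum>x\<in>A. (1 / card A) *\<^sub>R f x) \<le> (\<Sum>x\<in>A. 1 / card A * exp (f x))"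
    using assms by (intro convex_on_sum[OF _ _ exp_convex]) auto
  then show ?thesis by (simp add: sum_divide_distrib)
qed

lemma index_agreement_bound:
  fixes decoder :: "'b \<Rightarrow> 'i set" and \<gamma> :: real
  assumes "finite I" "finite B" "msg ` Pow I \<subseteq> B" "0 \<le> \<gamma>"
    and average: "2 ^ card I * ((1/2 + \<gamma>) * card I)
      \<le> (\<Sum>S\<in>Pow I. real (card (agreements I S (decoder (msg S)))))"
  shows "2 * \<gamma>\<^sup>2 * card I \<le> ln (card B)"
proof -
  define m where "m = card I"
  define agree where "agree S = card (agreements I S (decoder (msg S)))" for S
  define l where "l = 4 * \<gamma>" \<comment> \<open>the optimal parameter of Chernoff's bound\<close>
  have "card B > 0" using assms(2,3) by (auto simp: card_gt_0_iff)
  have "0 \<le> l" using \<open>0 \<le> \<gamma>\<close> by (simp add: l_def)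
  then have "l * ((1/2 + \<gamma>) * m) * 2 ^ m \<le> (\<Sum>S\<in>Pow I. l * agree S)"
    using mult_left_mono[OF average, of l]
    by (simp add: m_def agree_def ac_simps flip: sum_distrib_left)
  then have "exp (l * ((1/2 + \<gamma>) * m)) \<le> exp ((\<Sum>S\<in>Pow I. l * agree S) / 2 ^ m)"
    by (simp add: pos_le_divide_eq)
  also have "\<dots> \<le> (\<Sum>S\<in>Pow I. exp l ^ agree S) / 2 ^ m"
    using exp_average_le[of "Pow I" "\<lambda>S. l * agree S"] assms(1)
    by (auto simp: card_Pow m_def exp_of_nat2_mult)
  also have "\<dots> \<le> card B * (1 + exp l) ^ m / 2 ^ m"
    unfolding agree_def m_def
    using sum_power_card_agreements_decoder_le[OF assms(1-3), of "exp l" decoder]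
    by (intro divide_right_mono) auto
  also have "\<dots> = card B * ((1 + exp l) / 2) ^ m" by (simp add: power_divide)
  also have "\<dots> \<le> card B * exp (l / 2 + l\<^sup>2 / 8) ^ m"
    using one_plus_exp_half_le[OF \<open>0 \<le> l\<close>]
    by (intro mult_left_mono power_mono) (auto simp: add_nonneg_nonneg)
  also have "\<dots> = exp (ln (card B) + m * (l / 2 + l\<^sup>2 / 8))"
    using \<open>card B > 0\<close> by (simp add: exp_add exp_of_nat_mult)
  finally have "l * ((1/2 + \<gamma>) * m) \<le> ln (card B) + m * (l / 2 + l\<^sup>2 / 8)" by simp
  then show ?thesis by (simp add: l_def m_def power2_eq_square algebra_simps)
qed

lemma index_decoding_bound:
  fixes msg :: "'i set \<Rightarrow> 'b" and \<gamma> :: real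
  assumes "finite I" "finite B" "msg ` Pow I \<subseteq> B" "0 \<le> \<gamma>"
    and decodable: "\<And>S S' i. \<lbrakk>S \<subseteq> I; S' \<subseteq> I; i \<in> success S; i \<in> success S';
        msg S = msg S'; i \<in> S\<rbrakk> \<Longrightarrow> i \<in> S'"
    and average: "2 ^ card I * ((1/2 + \<gamma>) * card I) \<le> (\<Sum>S\<in>Pow I. real (card (I \<inter> success S)))"
  shows "2 * \<gamma>\<^sup>2 * card I \<le> ln (card B)"
proof (rule index_agreement_bound[OF assms(1-4)])
  define decoder where "decoder z = {i. \<exists>S\<subseteq>I. msg S = z \<and> i \<in> success S \<inter> S}" for z
  have "I \<inter> success S \<subseteq> agreements I S (decoder (msg S))" if "S \<subseteq> I" for S
    using that decodable unfolding decoder_def agreements_def by blast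
  then have "card (I \<inter> success S) \<le> card (agreements I S (decoder (msg S)))" if "S \<subseteq> I" for S
    using that assms(1) by (intro card_mono) (auto simp: agreements_def)
  then have "(\<Sum>S\<in>Pow I. real (card (I \<inter> success S)))
      \<le> (\<Sum>S\<in>Pow I. real (card (agreements I S (decoder (msg S)))))"
    by (intro sum_mono) simp
  with average show "2 ^ card I * ((1/2 + \<gamma>) * card I)
      \<le> (\<Sum>S\<in>Pow I. real (card (agreements I S (decoder (msg S)))))"
    by (rule order_trans)
qed

lemma (in prob_space) randomized_index_bound:
  fixes msg :: "'a \<Rightarrow> 'i set \<Rightarrow> 'b" and success :: "'i set \<Rightarrow> 'i \<Rightarrow> 'a set" and \<gamma> :: real
  assumes "finite I" "finite B" "0 \<le> \<gamma>"
    and success: "\<And>S i. \<lbrakk>S \<subseteq> I; i \<in> I\<rbrakk> \<Longrightarrow> success S i \<in> events"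
      "\<And>S i. \<lbrakk>S \<subseteq> I; i \<in> I\<rbrakk> \<Longrightarrow> 1/2 + \<gamma> \<le> prob (success S i)"
    and msg: "\<And>S. S \<subseteq> I \<Longrightarrow> AE \<omega> in M. msg \<omega> S \<in> B"
    and decodable: "\<And>\<omega> S S' i. \<lbrakk>S \<subseteq> I; S' \<subseteq> I; i \<in> I; \<omega> \<in> success S i; \<omega> \<in> success S' i;
        msg \<omega> S = msg \<omega> S'; i \<in> S\<rbrakk> \<Longrightarrow> i \<in> S'"
  shows "2 * \<gamma>\<^sup>2 * card I \<le> ln (card B)"
proof (rule ccontr)
  assume less: "\<not> 2 * \<gamma>\<^sup>2 * card I \<le> ln (card B)"
  define threshold where "threshold = 2 ^ card I * ((1/2 + \<gamma>) * card I)"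
  define total where "total \<omega> = (\<Sum>S\<in>Pow I. \<Sum>i\<in>I. indicator (success S i) \<omega> :: real)" for \<omega>
  have integrable_success: "integrable M (indicator (success S i) :: 'a \<Rightarrow> real)"
    if "S \<in> Pow I" "i \<in> I" for S i
    using success(1) that by (simp add: emeasure_eq_measure)
  have "AE \<omega> in M. \<forall>S\<in>Pow I. msg \<omega> S \<in> B"
    using assms(1) msg by (intro AE_finite_allI) auto
  then have "AE \<omega> in M. total \<omega> < threshold"
  proof eventually_elim
    case (elim \<omega>)
    have "\<not> threshold \<le> (\<Sum>S\<in>Pow I. real (card (I \<inter> {i. \<omega> \<in> success S i})))"
      using less index_decoding_bound[OF assms(1,2) _ assms(3), of "msg \<omega>" "\<lambda>S. {i. \<omega> \<in> success S i}"]
        elim decodable unfolding threshold_def by blast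
    moreover have "(\<Sum>i\<in>I. indicator (success S i) \<omega>) = real (card (I \<inter> {i. \<omega> \<in> success S i}))" for S
      using assms(1) by (simp add: indicator_def sum.If_cases Int_def)
    ultimately show ?case by (simp add: total_def)
  qed
  then have "expectation total < threshold"
    unfolding total_def using integrable_success
    by (intro expectation_less Bochner_Integration.integrable_sum) auto
  moreover have "threshold = (\<Sum>S\<in>Pow I. \<Sum>i\<in>I. 1/2 + \<gamma>)"
    using assms(1) by (simp add: threshold_def card_Pow)
  moreover have "\<dots> \<le> (\<Sum>S\<in>Pow I. \<Sum>i\<in>I. prob (success S i))"
    using success(2) by (intro sum_mono) auto
  moreover have "\<dots> = expectation total"
    unfolding total_def using integrable_success success(1)
    by (simp add: Bochner_Integration.integral_sum)
  ultimately show False by linarith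
qed

section \<open>Memory of asymptotically exact algorithms\<close>

lemma memory_state_cong:
  assumes "\<And>t. t < n \<Longrightarrow> P t = Q t"
  shows "memory_state A \<omega> P n = memory_state A \<omega> Q n"
  using assms by (induction n) auto

lemma output_centers_shift_cong:
  assumes "length xs = length ys"
    and same: "memory_state A \<omega> ((!) xs) (length xs) = memory_state A \<omega> ((!) ys) (length ys)"
    and "length xs \<le> t"
  shows "output_centers A \<omega> (snth (xs @- T)) t = output_centers A \<omega> (snth (ys @- T)) t"
proof -
  have read: "memory_state A \<omega> (snth (zs @- T)) (length zs)
      = memory_state A \<omega> ((!) zs) (length zs)" for zs
    by (rule memory_state_cong) simp
  have "memory_state A \<omega> (snth (xs @- T)) t = memory_state A \<omega> (snth (ys @- T)) t"
    using \<open>length xs \<le> t\<close>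
  proof (induction t rule: dec_induct)
    case base
    show ?case using read[of xs] read[of ys] same assms(1) by simp
  next
    case (step t)
    then show ?case using assms(1) by simp
  qed
  then show ?thesis by (simp add: output_centers_def)
qed

definition asymptotically_optimal ::
  "'d::finite clustering_cost \<Rightarrow> nat \<Rightarrow> (nat \<Rightarrow> real ^ 'd) \<Rightarrow> (nat \<Rightarrow> (real ^ 'd) set) \<Rightarrow> bool" where
  "asymptotically_optimal cost k P C \<longleftrightarrow>
     (\<forall>\<^sub>F n in sequentially. finite (C n) \<and> card (C n) = k) \<and>
     (\<lambda>n. cost P n (C n) / opt_cost cost k P n) \<longlonglongrightarrow> 1"

lemma asymptotically_optimal_eventually_cong:
  assumes "asymptotically_optimal cost k P C" and eventually_eq: "\<forall>\<^sub>F n in sequentially. C n = C' n"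
  shows "asymptotically_optimal cost k P C'"
proof -
  have "\<forall>\<^sub>F n in sequentially. finite (C' n) \<and> card (C' n) = k"
    using assms(1) eventually_eq unfolding asymptotically_optimal_def
    by (auto elim: eventually_elim2)
  moreover have "(\<lambda>n. cost P n (C' n) / opt_cost cost k P n) \<longlonglongrightarrow> 1"
    using assms(1) unfolding asymptotically_optimal_def
    by (auto elim!: Lim_transform_eventually intro: eventually_mono[OF eventually_eq])
  ultimately show ?thesis by (simp add: asymptotically_optimal_def)
qed

lemma asymptotically_exact_prob_ge:
  assumes "asymptotically_exact cost k \<delta> X A" "range P \<subseteq> X"
    and "\<forall>\<^sub>F n in sequentially. 0 < opt_cost cost k P n"
  shows "1 - \<delta> \<le> measure (coins A)
    {\<omega> \<in> space (coins A). asymptotically_optimal cost k P (output_centers A \<omega> P)}"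
proof -
  have "{\<omega> \<in> space (coins A). asymptotically_optimal cost k P (output_centers A \<omega> P)} =
      {\<omega> \<in> space (coins A). (\<lambda>n. cost P n (output_centers A \<omega> P n) / opt_cost cost k P n) \<longlonglongrightarrow> 1}"
    using assms(1,2) by (auto simp: asymptotically_exact_def asymptotically_optimal_def)
  then show ?thesis using assms by (simp add: asymptotically_exact_def)
qed

lemma ln_card_bool_lists_le: "ln (real (card {xs :: bool list. length xs \<le> s})) \<le> real s + 1"
proof -
  have "card {xs :: bool list. length xs \<le> s} = (\<Sum>i\<le>s. 2 ^ i)"
    using card_lists_length_le[of "UNIV :: bool set" s] by simp
  also have "\<dots> < 2 ^ (s + 1)" by (induction s) auto
  finally have "real (card {xs :: bool list. length xs \<le> s}) \<le> 2 ^ (s + 1)"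
    by (metis less_imp_le of_nat_le_iff of_nat_numeral of_nat_power)
  moreover have "0 < card {xs :: bool list. length xs \<le> s}"
    using finite_lists_length_le[of "UNIV :: bool set" s]
    by (auto simp: card_gt_0_iff intro: exI[of _ "[]"])
  ultimately have "ln (real (card {xs :: bool list. length xs \<le> s})) \<le> ln (2 ^ (s + 1))"
    by (intro ln_mono) auto
  also have "\<dots> = (real s + 1) * ln 2" by (simp add: ln_realpow del: power_Suc)
  also have "\<dots> \<le> real s + 1" using ln_2_less_1 by (simp add: mult_left_le)
  finally show ?thesis .
qed

lemma streaming_index_bound:
  fixes A :: "('r, 'd::finite) streaming_alg" and I :: "'i set"
    and code :: "'i set \<Rightarrow> (real ^ 'd) list" and query :: "'i \<Rightarrow> (real ^ 'd) stream"
  defines "P \<equiv> \<lambda>S i. snth (code S @- query i)"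
  assumes exact: "asymptotically_exact cost k \<delta> X A" and "\<delta> < 1/2" and mem: "uses_memory A s"
    and "finite I"
    and code: "\<And>S. length (code S) = n"
      "\<And>S p j. p \<in> set (code S) \<Longrightarrow> p \<in> integer_points \<and> \<bar>p $ j\<bar> \<le> real n"
    and streams: "\<And>S i. i \<in> I \<Longrightarrow> range (P S i) \<subseteq> X"
      "\<And>S i. i \<in> I \<Longrightarrow> \<forall>\<^sub>F t in sequentially. 0 < opt_cost cost k (P S i) t"
    and incompatible: "\<And>S S' i C. \<lbrakk>i \<in> I; i \<in> S; i \<notin> S'; asymptotically_optimal cost k (P S i) C\<rbrakk>
      \<Longrightarrow> \<not> asymptotically_optimal cost k (P S' i) C"
  shows "2 * (1/2 - \<delta>)\<^sup>2 * card I \<le> real (s n) + 1"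
proof -
  interpret prob_space "coins A" using exact by (simp add: asymptotically_exact_def)
  define success where "success S i = {\<omega> \<in> space (coins A).
    asymptotically_optimal cost k (P S i) (output_centers A \<omega> (P S i))}" for S i
  define msg where "msg \<omega> S = memory_state A \<omega> ((!) (code S)) n" for \<omega> S
  have prob_success: "1/2 + (1/2 - \<delta>) \<le> prob (success S i)" if "i \<in> I" for S i
    unfolding success_def using asymptotically_exact_prob_ge[OF exact streams[OF that]] by simp
  have "2 * (1/2 - \<delta>)\<^sup>2 * card I \<le> ln (card {xs :: bool list. length xs \<le> s n})"
  proof (rule randomized_index_bound[where success = success and msg = msg])
    show "finite {xs :: bool list. length xs \<le> s n}"
      using finite_lists_length_le[of "UNIV :: bool set"] by simp
    show "success S i \<in> events" if "i \<in> I" for S i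
      using prob_success[OF that, of S] \<open>\<delta> < 1/2\<close> measure_notin_sets[of "success S i" "coins A"]
      by force
    show "AE \<omega> in coins A. msg \<omega> S \<in> {xs. length xs \<le> s n}" for S
    proof -
      have "code S ! t \<in> integer_points \<and> \<bar>code S ! t $ j\<bar> \<le> real n" if "t < n" for t j
        using that code(1) by (intro code(2)[of _ S]) simp
      then show ?thesis using mem by (simp add: uses_memory_def msg_def)
    qed
  next
    fix \<omega> S S' i
    assume bit: "i \<in> I" "i \<in> S" and good: "\<omega> \<in> success S i" "\<omega> \<in> success S' i"
      and "msg \<omega> S = msg \<omega> S'"
    then have "\<forall>\<^sub>F t in sequentially.
        output_centers A \<omega> (P S' i) t = output_centers A \<omega> (P S i) t"
      unfolding P_def msg_def using code(1)
      by (intro eventually_sequentiallyI[of n] output_centers_shift_cong) auto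
    then have "asymptotically_optimal cost k (P S' i) (output_centers A \<omega> (P S i))"
      using good(2) unfolding success_def by (auto intro: asymptotically_optimal_eventually_cong)
    then show "i \<in> S'" using incompatible bit good(1) unfolding success_def by blast
  qed (use assms prob_success in auto)
  also have "\<dots> \<le> real (s n) + 1" by (rule ln_card_bool_lists_le)
  finally show ?thesis .
qed

section \<open>Costs of ultimately periodic streams\<close>

definition power_cost :: "nat \<Rightarrow> 'a::metric_space list \<Rightarrow> 'a set \<Rightarrow> real" where
  "power_cost q xs C = (\<Sum>x\<leftarrow>xs. infdist x C ^ q)"

definition stream_cost :: "nat \<Rightarrow> (nat \<Rightarrow> 'a::metric_space) \<Rightarrow> nat \<Rightarrow> 'a set \<Rightarrow> real" where
  "stream_cost q P n C = (\<Sum>i<n. infdist (P i) C ^ q)"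

lemma kmedian_cost_eq_stream_cost: "kmedian_cost = stream_cost 1"
  by (intro ext) (simp add: kmedian_cost_def stream_cost_def)

lemma kmeans_cost_eq_stream_cost: "kmeans_cost = stream_cost 2"
  by (intro ext) (simp add: kmeans_cost_def stream_cost_def)

lemma power_cost_Nil [simp]: "power_cost q [] C = 0"
  by (simp add: power_cost_def)

lemma power_cost_Cons [simp]: "power_cost q (x # xs) C = infdist x C ^ q + power_cost q xs C"
  by (simp add: power_cost_def)

lemma power_cost_append [simp]: "power_cost q (xs @ ys) C = power_cost q xs C + power_cost q ys C"
  by (simp add: power_cost_def)

lemma power_cost_replicate [simp]: "power_cost q (replicate n x) C = real n * infdist x C ^ q"
  by (induction n) (auto simp: algebra_simps)

lemma power_cost_concat_replicate [simp]:
  "power_cost q (concat (replicate n xs)) C = real n * power_cost q xs C"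
  by (induction n) (auto simp: algebra_simps)

lemma power_cost_nonneg: "0 \<le> power_cost q xs C"
  by (induction xs) (auto simp: infdist_nonneg)

lemma power_cost_eq_0: "0 < q \<Longrightarrow> set xs \<subseteq> C \<Longrightarrow> power_cost q xs C = 0"
  by (induction xs) auto

lemma infdist_power_le_power_cost: "x \<in> set xs \<Longrightarrow> infdist x C ^ q \<le> power_cost q xs C"
  by (induction xs) (auto simp: power_cost_nonneg infdist_nonneg add_increasing add_increasing2)

lemma power_cost_mono:
  assumes "\<And>x. x \<in> set xs \<Longrightarrow> infdist x C \<le> infdist x D"
  shows "power_cost q xs C \<le> power_cost q xs D"
  unfolding power_cost_def using assms
  by (intro sum_list_mono power_mono) (auto simp: infdist_nonneg)

lemma power_cost_le:
  assumes "\<And>x. x \<in> set xs \<Longrightarrow> infdist x C \<le> r"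
  shows "power_cost q xs C \<le> real (length xs) * r ^ q"
proof -
  have "power_cost q xs C \<le> (\<Sum>x\<leftarrow>xs. r ^ q)"
    unfolding power_cost_def using assms by (intro sum_list_mono power_mono infdist_nonneg)
  then show ?thesis by (simp add: sum_list_triv)
qed

lemma stream_cost_eq_power_cost: "stream_cost q (snth P) n C = power_cost q (stake n P) C"
  by (simp add: stream_cost_def power_cost_def sum_list_sum_nth atLeast0LessThan)

lemma stream_cost_mono: "m \<le> n \<Longrightarrow> stream_cost q P m C \<le> stream_cost q P n C"
  unfolding stream_cost_def by (intro sum_mono2) (auto simp: infdist_nonneg)

lemma stream_cost_nonneg: "0 \<le> stream_cost q P n C"
  unfolding stream_cost_def by (simp add: infdist_nonneg sum_nonneg)

lemma stream_cost_shift_cycle: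
  assumes "zs \<noteq> []"
  shows "stream_cost q (snth (xs @- cycle zs)) (length xs + n * length zs) C
    = power_cost q xs C + real n * power_cost q zs C"
  using assms by (simp add: stream_cost_eq_power_cost stake_shift)

lemma stream_cost_shift_cycle_anchors:
  assumes "0 < q" "zs \<noteq> []" "set zs \<subseteq> C" "length xs \<le> n"
  shows "stream_cost q (snth (xs @- cycle zs)) n C = power_cost q xs C"
proof -
  have "set (stake (n - length xs) (cycle zs)) \<subseteq> sset (cycle zs)"
    by (auto simp: in_set_conv_nth)
  then show ?thesis using assms by (simp add: stream_cost_eq_power_cost stake_shift power_cost_eq_0)
qed

section \<open>Optimal costs\<close>

lemma opt_cost_le:
  assumes "finite C" "C \<noteq> {}" "card C \<le> k"
  shows "opt_cost (stream_cost q) k P n \<le> stream_cost q P n C"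
proof -
  obtain B where padding: "finite B" "card B = k - card C" "C \<inter> B = {}"
    using finite_arbitrarily_large_disj[OF infinite_UNIV_vec[OF infinite_UNIV_char_0] assms(1)]
    by blast
  have "opt_cost (stream_cost q) k P n \<le> stream_cost q P n (C \<union> B)"
    unfolding opt_cost_def using assms padding
    by (intro cINF_lower bdd_belowI2[where m = 0]) (auto simp: card_Un_disjoint stream_cost_nonneg)
  also have "\<dots> \<le> stream_cost q P n C"
    unfolding stream_cost_def using assms(2)
    by (intro sum_mono power_mono infdist_mono) (auto simp: infdist_nonneg)
  finally show ?thesis .
qed

lemma le_opt_cost:
  fixes P :: "nat \<Rightarrow> real ^ 'd::finite"
  assumes "\<And>C. finite C \<Longrightarrow> card C = k \<Longrightarrow> v \<le> cost P n C"
  shows "v \<le> opt_cost cost k P n"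
proof -
  obtain C :: "(real ^ 'd) set" where "finite C" "card C = k"
    using infinite_arbitrarily_large[OF infinite_UNIV_vec[OF infinite_UNIV_char_0]] by blast
  then show ?thesis unfolding opt_cost_def using assms by (intro cINF_greatest) auto
qed

lemma nearest_point_map:
  fixes C :: "'a::heine_borel set"
  assumes "finite C" "C \<noteq> {}"
  obtains f where "\<And>p. f p \<in> C" "\<And>p. infdist p C = dist p (f p)"
proof -
  have "\<exists>c. c \<in> C \<and> infdist p C = dist p c" for p
    using infdist_attains_inf[OF finite_imp_closed[OF assms(1)] assms(2), of p] by metis
  then show thesis using that by metis
qed

lemma finite_separated:
  fixes Z :: "'a::heine_borel set"
  assumes "finite Z"
  obtains d where "0 < d" "\<And>a b. a \<in> Z \<Longrightarrow> b \<in> Z \<Longrightarrow> dist a b < d \<Longrightarrow> a = b"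
proof -
  have "uniform_discrete Z" using assms uniform_discrete_finite_iff by auto
  then obtain d where "0 < d" "\<forall>a\<in>Z. \<forall>b\<in>Z. dist a b < d \<longrightarrow> a = b"
    unfolding uniform_discrete_def by auto
  then show thesis by (intro that[of d]) auto
qed

lemma opt_cost_pos:
  fixes P :: "nat \<Rightarrow> real ^ 'd::finite"
  assumes "0 < k" and distinct: "k < card (P ` {..<n})"
  shows "0 < opt_cost (stream_cost q) k P n"
proof -
  obtain d where separated: "0 < d" "\<And>a b. a \<in> P ` {..<n} \<Longrightarrow> b \<in> P ` {..<n} \<Longrightarrow> dist a b < d \<Longrightarrow> a = b"
    using finite_separated[of "P ` {..<n}"] by blast
  have "(d / 2) ^ q \<le> stream_cost q P n C" if centers: "finite C" "card C = k" for C
  proof -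
    have "C \<noteq> {}" using centers \<open>0 < k\<close> by auto
    then obtain f where nearest: "\<And>p. f p \<in> C" "\<And>p. infdist p C = dist p (f p)"
      using nearest_point_map[OF centers(1)] by metis
    have "\<not> inj_on f (P ` {..<n})"
      using card_inj_on_le[of f "P ` {..<n}" C] nearest(1) centers distinct by auto
    then obtain i j where collision: "i < n" "j < n" "P i \<noteq> P j" "f (P i) = f (P j)"
      unfolding inj_on_def by blast
    have "d \<le> dist (P i) (P j)" using separated(2)[of "P i" "P j"] collision by force
    also have "\<dots> \<le> infdist (P i) C + infdist (P j) C"
      using dist_triangle2[of "P i" "P j" "f (P i)"] nearest(2) collision(4) by metis
    finally obtain t where far: "t < n" "d / 2 \<le> infdist (P t) C"
      using collision(1,2) by (cases "d / 2 \<le> infdist (P i) C") force+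
    then have "(d / 2) ^ q \<le> infdist (P t) C ^ q" using separated(1) by (intro power_mono) auto
    also have "\<dots> \<le> stream_cost q P n C"
      unfolding stream_cost_def using far
      by (intro member_le_sum[of t _ "\<lambda>t. infdist (P t) C ^ q"]) (auto simp: infdist_nonneg)
    finally show ?thesis .
  qed
  then have "(d / 2) ^ q \<le> opt_cost (stream_cost q) k P n" by (rule le_opt_cost)
  moreover have "0 < (d / 2) ^ q" using separated(1) by simp
  ultimately show ?thesis by linarith
qed

lemma opt_cost_shift_cycle_eventually_pos:
  assumes "0 < k" "zs \<noteq> []" "k < card (set xs \<union> set zs)"
  shows "\<forall>\<^sub>F n in sequentially. 0 < opt_cost (stream_cost q) k (snth (xs @- cycle zs)) n"
proof (rule eventually_sequentiallyI)
  let ?P = "xs @- cycle zs"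
  fix n assume "length xs + length zs \<le> n"
  moreover have "set xs \<union> set zs = set (stake (length xs + length zs) ?P)"
    using assms(2) by (simp add: stake_shift)
  ultimately have "set xs \<union> set zs \<subseteq> snth ?P ` {..<n}"
    by (force simp: in_set_conv_nth)
  then have "card (set xs \<union> set zs) \<le> card (snth ?P ` {..<n})" by (intro card_mono) auto
  then show "0 < opt_cost (stream_cost q) k (snth ?P) n"
    using assms by (intro opt_cost_pos) auto
qed

lemma asymptotically_optimal_eventually_less:
  assumes optimal: "asymptotically_optimal (stream_cost q) k P C"
    and bound: "\<forall>\<^sub>F n in sequentially. opt_cost (stream_cost q) k P n \<le> v" and "0 < \<eta>"
  shows "\<forall>\<^sub>F n in sequentially. stream_cost q P n (C n) < opt_cost (stream_cost q) k P n + \<eta>"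
proof -
  have opt_nonneg: "0 \<le> opt_cost (stream_cost q) k P n" for n
    by (intro le_opt_cost stream_cost_nonneg)
  have ratio: "(\<lambda>n. stream_cost q P n (C n) / opt_cost (stream_cost q) k P n) \<longlonglongrightarrow> 1"
    using optimal by (simp add: asymptotically_optimal_def)
  have "1 < 1 + \<eta> / (\<bar>v\<bar> + 1)" using \<open>0 < \<eta>\<close> by simp
  from order_tendstoD(1)[OF ratio zero_less_one] order_tendstoD(2)[OF ratio this] bound
  show ?thesis
  proof eventually_elim
    case (elim n)
    let ?opt = "opt_cost (stream_cost q) k P n"
    \<comment> \<open>a vanishing optimum would make the quotient \<open>0\<close>\<close>
    have "0 < ?opt" using elim(1) opt_nonneg[of n] by (cases "?opt = 0") auto
    then have "stream_cost q P n (C n) < ?opt + \<eta> * (?opt / (\<bar>v\<bar> + 1))"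
      using elim(2) by (simp add: pos_divide_less_eq algebra_simps)
    also have "\<dots> \<le> ?opt + \<eta>"
      using elim(3) \<open>0 < \<eta>\<close> by (intro add_left_mono mult_left_le) auto
    finally show ?case .
  qed
qed

section \<open>The free center\<close>

definition almost_optimal_centers :: "nat \<Rightarrow> 'a::metric_space set \<Rightarrow> 'a list \<Rightarrow> real \<Rightarrow> 'a set" where
  "almost_optimal_centers q Z xs \<eta> =
     {c. \<forall>z. power_cost q xs (insert c Z) < power_cost q xs (insert z Z) + \<eta>}"

definition displacement :: "'a::metric_space set \<Rightarrow> 'a set \<Rightarrow> real" where
  "displacement Z C = (\<Sum>a\<in>Z. infdist a C)"

definition free_center :: "'a::metric_space set \<Rightarrow> 'a set \<Rightarrow> 'a \<Rightarrow> bool" where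
  "free_center Z C c \<longleftrightarrow> (\<forall>p. infdist p (insert c Z) \<le> infdist p C + displacement Z C)"

lemma asymptotically_optimal_periodic_cost_less:
  fixes xs zs :: "(real ^ 'd::finite) list"
  defines "P \<equiv> snth (xs @- cycle zs)"
  assumes "0 < q" "zs \<noteq> []" "card (set zs) < k" "0 < \<eta>"
    and optimal: "asymptotically_optimal (stream_cost q) k P C"
  shows "\<forall>\<^sub>F t in sequentially. \<forall>z.
    power_cost q xs (C t) + real n * power_cost q zs (C t) < power_cost q xs (insert z (set zs)) + \<eta>"
proof -
  have opt_le: "opt_cost (stream_cost q) k P t \<le> power_cost q xs (insert z (set zs))"
    if "length xs \<le> t" for t z
  proof -
    have "opt_cost (stream_cost q) k P t \<le> stream_cost q P t (insert z (set zs))"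
      using \<open>card (set zs) < k\<close> by (intro opt_cost_le) (auto simp: card_insert_if)
    also have "\<dots> = power_cost q xs (insert z (set zs))"
      unfolding P_def using assms that by (intro stream_cost_shift_cycle_anchors) auto
    finally show ?thesis .
  qed
  then have "\<forall>\<^sub>F t in sequentially.
      opt_cost (stream_cost q) k P t \<le> power_cost q xs (insert undefined (set zs))"
    by (rule eventually_sequentiallyI)
  from asymptotically_optimal_eventually_less[OF optimal this \<open>0 < \<eta>\<close>]
    eventually_ge_at_top[of "length xs + n * length zs"]
  show ?thesis
  proof eventually_elim
    case (elim t)
    have "power_cost q xs (C t) + real n * power_cost q zs (C t) \<le> stream_cost q P t (C t)"
      using stream_cost_mono[OF elim(2), of q P "C t"] \<open>zs \<noteq> []\<close>
      by (simp add: P_def stream_cost_shift_cycle)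
    moreover have "opt_cost (stream_cost q) k P t \<le> power_cost q xs (insert z (set zs))" for z
      using elim(2) by (intro opt_le) simp
    ultimately show ?case using elim(1) by (smt (verit))
  qed
qed

lemma anchor_infdist_tendsto_0:
  fixes xs zs :: "(real ^ 'd::finite) list"
  assumes "0 < q" "card (set zs) < k"
    and optimal: "asymptotically_optimal (stream_cost q) k (snth (xs @- cycle zs)) C"
    and "a \<in> set zs"
  shows "(\<lambda>t. infdist a (C t)) \<longlonglongrightarrow> 0"
proof (rule tendstoI)
  fix \<epsilon> :: real assume "0 < \<epsilon>"
  define v where "v = power_cost q xs (insert undefined (set zs)) + 1"
  obtain n :: nat where rounds: "v / \<epsilon> ^ q < real n" using reals_Archimedean2 by blast
  have "zs \<noteq> []" using \<open>a \<in> set zs\<close> by auto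
  from asymptotically_optimal_periodic_cost_less
    [OF \<open>0 < q\<close> this \<open>card (set zs) < k\<close> zero_less_one optimal, of n]
  show "\<forall>\<^sub>F t in sequentially. dist (infdist a (C t)) 0 < \<epsilon>"
  proof eventually_elim
    case (elim t)
    have "real n * infdist a (C t) ^ q \<le> real n * power_cost q zs (C t)"
      using infdist_power_le_power_cost[OF \<open>a \<in> set zs\<close>] by (simp add: mult_left_mono)
    also have "\<dots> < v"
      using elim[rule_format, of undefined] power_cost_nonneg[of q xs "C t"] unfolding v_def
      by linarith
    also have "v < real n * \<epsilon> ^ q" using rounds \<open>0 < \<epsilon>\<close> by (simp add: pos_divide_less_eq)
    finally have "infdist a (C t) ^ q < \<epsilon> ^ q" by (simp add: mult_less_cancel_left)
    then show ?case
      using \<open>0 < \<epsilon>\<close> by (auto simp: dist_real_def infdist_nonneg intro: power_less_imp_less_base)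
  qed
qed

lemma power_le_perturb:
  fixes B \<eta> :: real
  assumes "0 < \<eta>"
  obtains d where "0 < d" "\<And>x y. \<lbrakk>0 \<le> x; x \<le> B; 0 \<le> y; x \<le> y + d\<rbrakk> \<Longrightarrow> x ^ q \<le> y ^ q + \<eta>"
proof -
  have "uniformly_continuous_on {0..B} (\<lambda>x::real. x ^ q)"
    by (intro compact_uniformly_continuous continuous_intros) auto
  then obtain d where continuous: "0 < d"
    "\<And>x y. x \<in> {0..B} \<Longrightarrow> y \<in> {0..B} \<Longrightarrow> dist y x < d \<Longrightarrow> dist (y ^ q) (x ^ q) < \<eta>"
    using assms unfolding uniformly_continuous_on_def by metis
  show thesis
  proof (rule that[of "d / 2"])
    fix x y assume bounds: "0 \<le> x" "x \<le> B" "0 \<le> y" "x \<le> y + d / 2"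
    show "x ^ q \<le> y ^ q + \<eta>"
    proof (cases "x \<le> y")
      case True
      then show ?thesis using power_mono[OF True bounds(1), of q] assms by linarith
    next
      case False
      then have "dist (x ^ q) (y ^ q) < \<eta>" using bounds continuous(1)
        by (intro continuous(2)) (auto simp: dist_real_def)
      then show ?thesis by (simp add: dist_real_def)
    qed
  qed (use continuous(1) in simp)
qed

lemma power_cost_le_perturb:
  assumes "Z \<noteq> {}" "0 < \<eta>"
  obtains \<epsilon> where "0 < \<epsilon>"
    "\<And>C D. Z \<subseteq> D \<Longrightarrow> (\<And>p. infdist p D \<le> infdist p C + \<epsilon>) \<Longrightarrow>
       power_cost q xs D \<le> power_cost q xs C + \<eta>"
proof -
  define B where "B = power_cost 1 xs Z"
  have "0 < \<eta> / (length xs + 1)" using assms by simp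
  then obtain \<epsilon> where perturb: "0 < \<epsilon>"
    "\<And>x y. \<lbrakk>0 \<le> x; x \<le> B; 0 \<le> y; x \<le> y + \<epsilon>\<rbrakk> \<Longrightarrow> x ^ q \<le> y ^ q + \<eta> / (length xs + 1)"
    using power_le_perturb by metis
  show thesis
  proof (rule that[OF perturb(1)])
    fix C D assume "Z \<subseteq> D" and close: "\<And>p. infdist p D \<le> infdist p C + \<epsilon>"
    have "infdist x D ^ q \<le> infdist x C ^ q + \<eta> / (length xs + 1)" if "x \<in> set xs" for x
    proof (rule perturb(2)[OF infdist_nonneg _ infdist_nonneg close])
      show "infdist x D \<le> B"
        using infdist_mono[OF \<open>Z \<subseteq> D\<close> \<open>Z \<noteq> {}\<close>, of x] infdist_power_le_power_cost[OF that, of Z 1]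
        unfolding B_def by simp
    qed
    then have "power_cost q xs D \<le> (\<Sum>x\<leftarrow>xs. infdist x C ^ q + \<eta> / (length xs + 1))"
      unfolding power_cost_def by (rule sum_list_mono)
    also have "\<dots> = power_cost q xs C + length xs * (\<eta> / (length xs + 1))"
      by (simp add: sum_list_addf sum_list_triv power_cost_def)
    also have "\<dots> \<le> power_cost q xs C + \<eta>" using assms by (simp add: field_simps)
    finally show "power_cost q xs D \<le> power_cost q xs C + \<eta>" .
  qed
qed

lemma displacement_tendsto_0:
  fixes xs zs :: "(real ^ 'd::finite) list"
  assumes "0 < q" "card (set zs) < k"
    and "asymptotically_optimal (stream_cost q) k (snth (xs @- cycle zs)) C"
  shows "(\<lambda>t. displacement (set zs) (C t)) \<longlonglongrightarrow> 0"
  unfolding displacement_def using anchor_infdist_tendsto_0[OF assms] by (rule tendsto_null_sum)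

lemma free_center_exists:
  fixes C Z :: "'a::heine_borel set"
  assumes "finite C" "finite Z" "card C = card Z + 1"
    and separated: "\<And>a b. a \<in> Z \<Longrightarrow> b \<in> Z \<Longrightarrow> dist a b < d \<Longrightarrow> a = b"
    and near: "displacement Z C < d / 2"
  shows "\<exists>c. free_center Z C c"
proof -
  have "C \<noteq> {}" using assms(3) by auto
  then obtain f where nearest: "\<And>p. f p \<in> C" "\<And>p. infdist p C = dist p (f p)"
    using nearest_point_map[OF \<open>finite C\<close>] by metis
  have close: "dist a (f a) \<le> displacement Z C" if "a \<in> Z" for a
    using member_le_sum[of a Z "\<lambda>a. infdist a C"] that \<open>finite Z\<close>
    by (simp add: displacement_def nearest(2)[symmetric] infdist_nonneg)
  have "inj_on f Z"
  proof (rule inj_onI)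
    fix a b assume same: "a \<in> Z" "b \<in> Z" "f a = f b"
    have "dist a b \<le> dist a (f a) + dist b (f a)" by (rule dist_triangle2)
    also have "\<dots> < d" using close[OF same(1)] close[OF same(2)] same(3) near by simp
    finally show "a = b" using separated same by blast
  qed
  then have "card (C - f ` Z) = 1"
    using assms(1-3) nearest(1) by (subst card_Diff_subset) (auto simp: card_image)
  then obtain c where free: "C - f ` Z = {c}" by (metis card_1_singletonE)
  have "infdist p (insert c Z) \<le> infdist p C + displacement Z C" for p
  proof (cases "f p = c")
    case True
    have "0 \<le> displacement Z C" by (simp add: displacement_def infdist_nonneg sum_nonneg)
    then show ?thesis using True nearest(2)[of p] infdist_le[of c "insert c Z" p] by simp
  next
    case False
    then obtain a where anchor: "a \<in> Z" "f p = f a" using free nearest(1)[of p] by blast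
    have "infdist p (insert c Z) \<le> dist p a" using anchor by (intro infdist_le) auto
    also have "\<dots> \<le> dist p (f a) + dist a (f a)" by (rule dist_triangle2)
    also have "\<dots> \<le> infdist p C + displacement Z C"
      using close[OF anchor(1)] nearest(2)[of p] anchor(2) by simp
    finally show ?thesis .
  qed
  then show ?thesis unfolding free_center_def by blast
qed

lemma free_center_almost_optimal:
  fixes xs zs :: "(real ^ 'd::finite) list"
  assumes "0 < q" "zs \<noteq> []" "card (set zs) < k" "0 < \<eta>"
    and optimal: "asymptotically_optimal (stream_cost q) k (snth (xs @- cycle zs)) C"
  shows "\<forall>\<^sub>F t in sequentially. \<forall>c.
    free_center (set zs) (C t) c \<longrightarrow> c \<in> almost_optimal_centers q (set zs) xs \<eta>"
proof -
  have half_pos: "0 < \<eta> / 2" using \<open>0 < \<eta>\<close> by simp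
  obtain \<epsilon> where perturb: "0 < \<epsilon>"
    "\<And>C D. set zs \<subseteq> D \<Longrightarrow> (\<And>p. infdist p D \<le> infdist p C + \<epsilon>) \<Longrightarrow>
       power_cost q xs D \<le> power_cost q xs C + \<eta> / 2"
    using power_cost_le_perturb[of "set zs" "\<eta> / 2" q xs] \<open>zs \<noteq> []\<close> half_pos by (metis set_empty)
  from order_tendstoD(2)[OF displacement_tendsto_0[OF assms(1,3) optimal] perturb(1)]
    asymptotically_optimal_periodic_cost_less[OF assms(1-3) half_pos optimal, of 0]
  show ?thesis
  proof eventually_elim
    case (elim t)
    have "power_cost q xs (insert c (set zs)) < power_cost q xs (insert z (set zs)) + \<eta>"
      if "free_center (set zs) (C t) c" for c z
    proof -
      have "infdist p (insert c (set zs)) \<le> infdist p (C t) + \<epsilon>" for p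
        using that elim(1) unfolding free_center_def by (smt (verit))
      then have "power_cost q xs (insert c (set zs)) \<le> power_cost q xs (C t) + \<eta> / 2"
        by (intro perturb(2)) auto
      then show ?thesis using elim(2)[rule_format, of z] by simp
    qed
    then show ?case by (simp add: almost_optimal_centers_def)
  qed
qed

lemma no_common_asymptotic_optimum:
  fixes xs ys zs :: "(real ^ 'd::finite) list"
  assumes "0 < q" "zs \<noteq> []" "card (set zs) + 1 = k" "0 < \<eta>"
    and disjoint: "almost_optimal_centers q (set zs) xs \<eta> \<inter> almost_optimal_centers q (set zs) ys \<eta> = {}"
    and optimal_xs: "asymptotically_optimal (stream_cost q) k (snth (xs @- cycle zs)) C"
  shows "\<not> asymptotically_optimal (stream_cost q) k (snth (ys @- cycle zs)) C"
proof
  assume optimal_ys: "asymptotically_optimal (stream_cost q) k (snth (ys @- cycle zs)) C"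
  have few_anchors: "card (set zs) < k" using assms(3) by simp
  obtain d where separated: "0 < d" "\<And>a b. a \<in> set zs \<Longrightarrow> b \<in> set zs \<Longrightarrow> dist a b < d \<Longrightarrow> a = b"
    using finite_separated[OF finite_set] by metis
  have "\<forall>\<^sub>F t in sequentially. displacement (set zs) (C t) < d / 2"
    using displacement_tendsto_0[OF assms(1) few_anchors optimal_xs] separated(1)
    by (intro order_tendstoD) auto
  moreover have "\<forall>\<^sub>F t in sequentially. finite (C t) \<and> card (C t) = k"
    using optimal_xs by (simp add: asymptotically_optimal_def)
  ultimately have "\<forall>\<^sub>F t in sequentially. False"
    using free_center_almost_optimal[OF assms(1,2) few_anchors assms(4) optimal_xs]
      free_center_almost_optimal[OF assms(1,2) few_anchors assms(4) optimal_ys]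
  proof eventually_elim
    case (elim t)
    then obtain c where "free_center (set zs) (C t) c"
      using free_center_exists[of "C t" "set zs" d] assms(3) separated(2) by auto
    then show ?case using elim(3,4) disjoint by blast
  qed
  then show False by simp
qed

section \<open>Locating the free center\<close>

lemma le_infdist: "Z \<noteq> {} \<Longrightarrow> (\<And>z. z \<in> Z \<Longrightarrow> r \<le> dist x z) \<Longrightarrow> r \<le> infdist x Z"
  by (simp add: infdist_notempty cINF_greatest)

lemma infdist_insert: "Z \<noteq> {} \<Longrightarrow> infdist x (insert c Z) = min (dist x c) (infdist x Z)"
  using infdist_Un_min[of "{c}" Z x] by simp

lemma almost_optimal_centers_cong_mset:
  assumes "mset xs = mset ys"
  shows "almost_optimal_centers q Z xs \<eta> = almost_optimal_centers q Z ys \<eta>"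
proof -
  have "power_cost q xs C = power_cost q ys C" for C
    by (simp add: power_cost_def assms flip: sum_mset_sum_list)
  then show ?thesis by (simp add: almost_optimal_centers_def)
qed

lemma dist_le_infdist_pair:
  assumes "Z \<noteq> {}" "dist x y \<le> infdist x Z" "dist x y \<le> infdist y Z"
  shows "dist x y \<le> infdist x (insert c Z) + infdist y (insert c Z)"
proof -
  have "dist x y \<le> dist x c + dist y c" by (rule dist_triangle2)
  then show ?thesis
    using assms(2,3) zero_le_dist[of x c] zero_le_dist[of y c] infdist_nonneg[of y Z]
    unfolding infdist_insert[OF assms(1)] by linarith
qed

text \<open>Each pair costs at least its distance, with equality for a center between its two points.
  Hence the one unpaired point decides.\<close>

lemma almost_optimal_center_paired:
  fixes p h :: "'i \<Rightarrow> 'a::metric_space"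
  assumes "Z \<noteq> {}"
    and far: "\<And>t. t \<in> set T \<Longrightarrow> dist (p t) (h t) \<le> infdist (p t) Z"
      "\<And>t. t \<in> set T \<Longrightarrow> dist (p t) (h t) \<le> infdist (h t) Z"
    and between: "\<And>t. t \<in> set T \<Longrightarrow> dist (p t) (h t) = dist (p t) z + dist (h t) z"
    and almost_optimal: "c \<in> almost_optimal_centers 1 Z (z # map p T @ map h T) \<eta>"
  shows "infdist z (insert c Z) < \<eta>"
proof -
  have cost: "power_cost 1 (z # map p T @ map h T) C
      = infdist z C + (\<Sum>t\<leftarrow>T. infdist (p t) C + infdist (h t) C)" for C
    by (simp add: power_cost_def sum_list_addf comp_def)
  have "(\<Sum>t\<leftarrow>T. infdist (p t) (insert z Z) + infdist (h t) (insert z Z)) \<le> (\<Sum>t\<leftarrow>T. dist (p t) (h t))"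
    by (intro sum_list_mono) (simp add: between add_mono infdist_le)
  also have "\<dots> \<le> (\<Sum>t\<leftarrow>T. infdist (p t) (insert c Z) + infdist (h t) (insert c Z))"
    using far \<open>Z \<noteq> {}\<close> by (intro sum_list_mono dist_le_infdist_pair)
  finally have "power_cost 1 (z # map p T @ map h T) (insert z Z) + infdist z (insert c Z)
      \<le> power_cost 1 (z # map p T @ map h T) (insert c Z)"
    unfolding cost by simp
  also have "\<dots> < power_cost 1 (z # map p T @ map h T) (insert z Z) + \<eta>"
    using almost_optimal by (simp only: almost_optimal_centers_def mem_Collect_eq)
  finally show ?thesis by simp
qed

lemma power_cost_insert_le:
  assumes "Z \<noteq> {}"
  shows "power_cost q (xs @ ys) (insert c Z) \<le> power_cost q xs Z + power_cost q ys {c}"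
  unfolding power_cost_append using assms
  by (intro add_mono power_cost_mono) (simp_all add: infdist_insert)

lemma power_cost_insert_eq:
  assumes "Z \<noteq> {}"
    and "\<And>x. x \<in> set xs \<Longrightarrow> infdist x Z \<le> dist x c" "\<And>y. y \<in> set ys \<Longrightarrow> dist y c \<le> infdist y Z"
  shows "power_cost q (xs @ ys) (insert c Z) = power_cost q xs Z + power_cost q ys {c}"
proof (rule antisym)
  show "power_cost q (xs @ ys) (insert c Z) \<le> power_cost q xs Z + power_cost q ys {c}"
    by (rule power_cost_insert_le[OF assms(1)])
  show "power_cost q xs Z + power_cost q ys {c} \<le> power_cost q (xs @ ys) (insert c Z)"
    unfolding power_cost_append using assms
    by (intro add_mono power_cost_mono) (simp_all add: infdist_insert)
qed

lemma power_cost_centroid: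
  fixes \<mu> :: "'a::real_inner"
  assumes "real (length xs) *\<^sub>R \<mu> = sum_list xs"
  shows "power_cost 2 xs {c} = power_cost 2 xs {\<mu>} + real (length xs) * (dist \<mu> c)\<^sup>2"
proof -
  have expand: "(dist x c)\<^sup>2 = (dist x \<mu>)\<^sup>2 + (dist \<mu> c)\<^sup>2 + 2 * inner (x - \<mu>) (\<mu> - c)" for x
    using dot_norm[of "x - \<mu>" "\<mu> - c"] by (simp add: dist_norm)
  have "(\<Sum>x\<leftarrow>xs. (dist x c)\<^sup>2)
      = (\<Sum>x\<leftarrow>xs. (dist x \<mu>)\<^sup>2 + (dist \<mu> c)\<^sup>2 + 2 * inner (x - \<mu>) (\<mu> - c))"
    by (intro arg_cong[of _ _ sum_list] map_cong refl expand)
  also have "\<dots> = (\<Sum>x\<leftarrow>xs. (dist x \<mu>)\<^sup>2) + real (length xs) * (dist \<mu> c)\<^sup>2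
      + 2 * inner (sum_list xs - real (length xs) *\<^sub>R \<mu>) (\<mu> - c)"
    by (induction xs) (auto simp: algebra_simps)
  finally show ?thesis using assms by (simp add: power_cost_def)
qed

text \<open>The many copies of \<open>b\<close> keep the free center within \<open>r\<close> of \<open>b\<close>, where it serves them and the
  points \<open>ys\<close> only.\<close>

lemma almost_optimal_center_centroid:
  fixes b \<mu> :: "'a::real_inner"
  assumes "Z \<noteq> {}" "0 < r"
    and others: "\<And>x. x \<in> set xs \<Longrightarrow> infdist x Z + r \<le> dist x b"
    and cluster: "\<And>y. y \<in> set ys \<Longrightarrow> dist y b + r \<le> infdist y Z" "r \<le> infdist b Z"
    and heavy: "power_cost 2 xs Z + power_cost 2 ys {b} + \<eta> \<le> real w * r\<^sup>2"
    and centroid: "real (length ys + w) *\<^sub>R \<mu> = sum_list (ys @ replicate w b)"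
    and almost_optimal: "c \<in> almost_optimal_centers 2 Z (xs @ ys @ replicate w b) \<eta>"
  shows "real (length ys + w) * (dist \<mu> c)\<^sup>2 < \<eta>"
proof -
  let ?ys = "ys @ replicate w b"
  have parallel_axis: "power_cost 2 ?ys {y}
      = power_cost 2 ?ys {\<mu>} + real (length ys + w) * (dist \<mu> y)\<^sup>2" for y
    using power_cost_centroid[of ?ys \<mu> y] centroid by simp
  have "power_cost 2 (xs @ ?ys) (insert c Z) < power_cost 2 (xs @ ?ys) (insert \<mu> Z) + \<eta>"
    using almost_optimal by (simp only: almost_optimal_centers_def mem_Collect_eq)
  also have "\<dots> \<le> power_cost 2 xs Z + power_cost 2 ?ys {\<mu>} + \<eta>"
    using power_cost_insert_le[OF \<open>Z \<noteq> {}\<close>, of 2 xs ?ys \<mu>] by simp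
  finally have upper: "power_cost 2 (xs @ ?ys) (insert c Z)
      < power_cost 2 xs Z + power_cost 2 ?ys {\<mu>} + \<eta>" .
  have "dist b c < r"
  proof (rule ccontr)
    assume "\<not> dist b c < r"
    then have "r\<^sup>2 \<le> (infdist b (insert c Z))\<^sup>2"
      using cluster(2) \<open>0 < r\<close> by (intro power_mono) (auto simp: infdist_insert[OF \<open>Z \<noteq> {}\<close>])
    then have "real w * r\<^sup>2 \<le> real w * (infdist b (insert c Z))\<^sup>2" by (rule mult_left_mono) simp
    also have "\<dots> \<le> power_cost 2 (xs @ ?ys) (insert c Z)" by (simp add: power_cost_nonneg)
    finally have "real w * r\<^sup>2 < power_cost 2 xs Z + power_cost 2 ?ys {\<mu>} + \<eta>"
      using upper by (rule le_less_trans)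
    moreover have "power_cost 2 ?ys {\<mu>} \<le> power_cost 2 ys {b}"
      using parallel_axis[of b] by simp
    ultimately show False using heavy by linarith
  qed
  have "power_cost 2 (xs @ ?ys) (insert c Z) = power_cost 2 xs Z + power_cost 2 ?ys {c}"
  proof (rule power_cost_insert_eq[OF \<open>Z \<noteq> {}\<close>])
    show "infdist x Z \<le> dist x c" if "x \<in> set xs" for x
      using others[OF that] \<open>dist b c < r\<close> dist_triangle2[of x b c] by linarith
    show "dist y c \<le> infdist y Z" if "y \<in> set ?ys" for y
      using that cluster \<open>dist b c < r\<close> dist_triangle[of y c b] by force
  qed
  then show ?thesis using upper parallel_axis[of c] by linarith
qed

section \<open>Encoding bits on a line\<close>

text \<open>\<open>undefined\<close> is an arbitrary coordinate.\<close>

definition axis_point :: "real \<Rightarrow> real ^ 'd" where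
  "axis_point a = a *\<^sub>R axis undefined 1"

lemma dist_axis_point [simp]: "dist (axis_point a) (axis_point b :: real ^ 'd::finite) = \<bar>a - b\<bar>"
  by (simp add: axis_point_def)

lemma axis_point_eq_iff [simp]: "axis_point a = (axis_point b :: real ^ 'd::finite) \<longleftrightarrow> a = b"
  by (simp add: axis_point_def axis_eq_0_iff)

lemma axis_point_integer: "a \<in> \<int> \<Longrightarrow> axis_point a \<in> integer_points"
  by (auto simp: integer_points_def axis_point_def axis_def)

lemma axis_point_component_le: "\<bar>axis_point a $ j\<bar> \<le> \<bar>a\<bar>"
  by (simp add: axis_point_def axis_def)

definition slot :: "nat \<Rightarrow> real" where
  "slot t = 4 * (real t + 1)"

definition code_pos :: "nat \<Rightarrow> nat set \<Rightarrow> nat \<Rightarrow> real" where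
  "code_pos m S t = (if t < m then slot t + of_bool (t \<in> S) else 0)"

definition code_points :: "nat \<Rightarrow> nat set \<Rightarrow> nat list \<Rightarrow> (real ^ 'd) list" where
  "code_points m S T = map (\<lambda>t. axis_point (code_pos m S t)) T"

definition index_code :: "nat \<Rightarrow> nat \<Rightarrow> nat set \<Rightarrow> (real ^ 'd) list" where
  "index_code n m S = code_points m S [0..<n]"

lemma code_pos_nonneg: "0 \<le> code_pos m S t"
  by (simp add: code_pos_def slot_def)

lemma code_pos_le: "4 * m + 1 \<le> n \<Longrightarrow> code_pos m S t \<le> real n"
  by (auto simp: code_pos_def slot_def)

lemma set_index_code_subset_integer_points: "set (index_code n m S) \<subseteq> integer_points"
  by (auto simp: index_code_def code_points_def code_pos_def slot_def intro!: axis_point_integer)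

lemma index_code_component_le:
  assumes "4 * m + 1 \<le> n" "p \<in> set (index_code n m S)"
  shows "\<bar>p $ j\<bar> \<le> real n"
proof -
  obtain t where point: "p = axis_point (code_pos m S t)"
    using assms(2) by (auto simp: index_code_def code_points_def)
  have "\<bar>p $ j\<bar> \<le> \<bar>code_pos m S t\<bar>" unfolding point by (rule axis_point_component_le)
  also have "\<dots> \<le> real n" using code_pos_nonneg[of m S t] code_pos_le[OF assms(1), of S t] by simp
  finally show ?thesis .
qed

lemma mset_index_code:
  assumes "i < n"
  shows "mset (index_code n m S)
    = add_mset (axis_point (code_pos m S i)) (mset (code_points m S (remove1 i [0..<n])))"
proof -
  have "mset [0..<n] = add_mset i (mset (remove1 i [0..<n]))" using assms by simp
  then show ?thesis by (simp only: index_code_def code_points_def mset_map image_mset_add_mset)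
qed

lemma opt_cost_index_code_eventually_pos:
  fixes query anchors :: "(real ^ 'd::finite) list"
  assumes "2 \<le> k" "4 * m + 1 \<le> n" "i < m" and card: "card (set anchors) + 1 = k"
    and fresh: "set anchors \<inter> {axis_point 0, axis_point (code_pos m S i)} = {}"
  shows "\<forall>\<^sub>F t in sequentially.
    0 < opt_cost (stream_cost q) k (snth (index_code n m S @- query @- cycle anchors)) t"
proof -
  let ?U = "{axis_point 0, axis_point (code_pos m S i) :: real ^ 'd}"
  have zero: "code_pos m S m = 0" "code_pos m S i \<noteq> 0" using \<open>i < m\<close>
    by (auto simp: code_pos_def slot_def)
  then have "axis_point 0 \<in> set (index_code n m S)"
      "axis_point (code_pos m S i) \<in> set (index_code n m S)"
    using assms(2,3) by (auto simp: index_code_def code_points_def intro: image_eqI[of _ _ m])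
  then have "card (?U \<union> set anchors) \<le> card (set (index_code n m S @ query) \<union> set anchors)"
    by (intro card_mono) auto
  moreover have "card (?U \<union> set anchors) = 2 + card (set anchors)"
    using fresh zero by (subst card_Un_disjoint) auto
  ultimately have "k < card (set (index_code n m S @ query) \<union> set anchors)" using card by simp
  moreover have "anchors \<noteq> []" using card \<open>2 \<le> k\<close> by auto
  ultimately have "\<forall>\<^sub>F t in sequentially.
      0 < opt_cost (stream_cost q) k (snth ((index_code n m S @ query) @- cycle anchors)) t"
    using \<open>2 \<le> k\<close> by (intro opt_cost_shift_cycle_eventually_pos) auto
  then show ?thesis by simp
qed

lemma index_code_bound:
  fixes A :: "('r, 'd::finite) streaming_alg"
    and query anchors :: "nat \<Rightarrow> (real ^ 'd) list"
    and center :: "nat set \<Rightarrow> nat \<Rightarrow> real ^ 'd"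
  assumes "integer_points \<subseteq> X" and exact: "asymptotically_exact (stream_cost q) k \<delta> X A"
    and "\<delta> < 1/2" "uses_memory A s" "0 < q" "2 \<le> k" and long_prefix: "4 * m + 1 \<le> n"
    and query: "\<And>i. i < m \<Longrightarrow> set (query i) \<subseteq> integer_points"
    and anchors: "\<And>i. i < m \<Longrightarrow> set (anchors i) \<subseteq> integer_points"
      "\<And>i. i < m \<Longrightarrow> card (set (anchors i)) + 1 = k"
      "\<And>S i. i < m \<Longrightarrow> set (anchors i) \<inter> {axis_point 0, axis_point (code_pos m S i)} = {}"
    and "0 < \<eta>"
    and located: "\<And>S i. i < m \<Longrightarrow>
      almost_optimal_centers q (set (anchors i)) (index_code n m S @ query i) \<eta> \<subseteq> ball (center S i) r"
    and distant: "\<And>S S' i. \<lbrakk>i < m; i \<in> S; i \<notin> S'\<rbrakk> \<Longrightarrow> 2 * r \<le> dist (center S i) (center S' i)"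
  shows "2 * (1/2 - \<delta>)\<^sup>2 * m \<le> real (s n) + 1"
proof -
  let ?P = "\<lambda>S i. snth (index_code n m S @- query i @- cycle (anchors i))"
  have nonempty: "anchors i \<noteq> []" if "i < m" for i using anchors(2)[OF that] \<open>2 \<le> k\<close> by auto
  have "2 * (1/2 - \<delta>)\<^sup>2 * card {..<m} \<le> real (s n) + 1"
  proof (rule streaming_index_bound[OF exact \<open>\<delta> < 1/2\<close> \<open>uses_memory A s\<close>,
        where code = "index_code n m" and query = "\<lambda>i. query i @- cycle (anchors i)"])
    show "p \<in> integer_points \<and> \<bar>p $ j\<bar> \<le> real n" if "p \<in> set (index_code n m S)" for S p j
      using that index_code_component_le[OF long_prefix] set_index_code_subset_integer_points
      by blast
    show "range (?P S i) \<subseteq> X" if "i \<in> {..<m}" for S i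
      using that query anchors(1) nonempty set_index_code_subset_integer_points \<open>integer_points \<subseteq> X\<close>
      by (simp add: sset_range[symmetric]) blast
    show "\<forall>\<^sub>F t in sequentially. 0 < opt_cost (stream_cost q) k (?P S i) t" if "i \<in> {..<m}" for S i
      using that anchors(2,3)
      by (intro opt_cost_index_code_eventually_pos[OF \<open>2 \<le> k\<close> long_prefix]) auto
    show "\<not> asymptotically_optimal (stream_cost q) k (?P S' i) C"
      if bit: "i \<in> {..<m}" "i \<in> S" "i \<notin> S'"
        and optimal: "asymptotically_optimal (stream_cost q) k (?P S i) C" for S S' i C
    proof -
      have index: "i < m" using bit(1) by simp
      have "ball (center S i) r \<inter> ball (center S' i) r = {}"
        using distant[OF index bit(2,3)] by (intro disjoint_ballI) simp
      then have disjoint: "almost_optimal_centers q (set (anchors i)) (index_code n m S @ query i) \<eta> \<inter>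
          almost_optimal_centers q (set (anchors i)) (index_code n m S' @ query i) \<eta> = {}"
        using located[OF index, of S] located[OF index, of S'] by blast
      then show ?thesis
        using no_common_asymptotic_optimum
          [OF \<open>0 < q\<close> nonempty[OF index] anchors(2)[OF index] \<open>0 < \<eta>\<close> disjoint, of C]
          optimal by simp
    qed
  qed (simp_all add: index_code_def code_points_def)
  then show ?thesis by simp
qed

section \<open>The k-median query\<close>

definition median_partner :: "nat \<Rightarrow> nat \<Rightarrow> nat \<Rightarrow> nat \<Rightarrow> real" where
  "median_partner n m i t = (if i < t \<and> t < m then 0 else real n)"

definition median_query :: "nat \<Rightarrow> nat \<Rightarrow> nat \<Rightarrow> (real ^ 'd) list" where
  "median_query n m i = map (\<lambda>t. axis_point (median_partner n m i t)) (remove1 i [0..<n])"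

definition median_anchors :: "nat \<Rightarrow> nat \<Rightarrow> (real ^ 'd) list" where
  "median_anchors n r = map (\<lambda>j. axis_point (2 * real n + 1 + real j)) [0..<r]"

lemma median_partner_between:
  assumes "i < m" "t \<noteq> i" and long_prefix: "4 * m + 1 \<le> n"
  shows "\<bar>code_pos m S t - median_partner n m i t\<bar>
    = \<bar>code_pos m S t - code_pos m S i\<bar> + \<bar>median_partner n m i t - code_pos m S i\<bar>"
proof -
  have "code_pos m S t \<le> code_pos m S i \<and> median_partner n m i t = real n \<or>
      code_pos m S i \<le> code_pos m S t \<and> median_partner n m i t = 0"
    using assms(1,2) by (auto simp: code_pos_def slot_def median_partner_def)
  then show ?thesis
    using code_pos_nonneg[of m S i] code_pos_nonneg[of m S t] code_pos_le[OF long_prefix, of S i]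
    by (auto simp: abs_if)
qed

lemma infdist_median_anchors_ge:
  assumes "0 < r" "a \<le> real n"
  shows "real n + 1 \<le> infdist (axis_point a :: real ^ 'd::finite) (set (median_anchors n r))"
  using assms by (intro le_infdist) (auto simp: median_anchors_def)

lemma almost_optimal_centers_median_query:
  assumes "i < m" "0 < r" and long_prefix: "4 * m + 1 \<le> n"
  shows "almost_optimal_centers 1 (set (median_anchors n r))
      (index_code n m S @ median_query n m i) (1/2)
    \<subseteq> ball (axis_point (code_pos m S i) :: real ^ 'd::finite) (1/2)"
proof
  fix c :: "real ^ 'd"
  assume almost_optimal: "c \<in> almost_optimal_centers 1 (set (median_anchors n r))
    (index_code n m S @ median_query n m i) (1/2)"
  let ?T = "remove1 i [0..<n]"
  let ?Z = "set (median_anchors n r) :: (real ^ 'd) set"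
  let ?p = "\<lambda>t. axis_point (code_pos m S t) :: real ^ 'd"
  let ?h = "\<lambda>t. axis_point (median_partner n m i t) :: real ^ 'd"
  have nonempty: "?Z \<noteq> {}" using \<open>0 < r\<close> by (simp add: median_anchors_def)
  note far = infdist_median_anchors_ge[OF \<open>0 < r\<close>, where 'd = 'd]
  have "mset (index_code n m S @ median_query n m i) = mset (?p i # map ?p ?T @ map ?h ?T)"
    using mset_index_code[of i n m S] \<open>i < m\<close> long_prefix
    by (simp add: median_query_def code_points_def)
  then have "c \<in> almost_optimal_centers 1 ?Z (?p i # map ?p ?T @ map ?h ?T) (1/2)"
    using almost_optimal almost_optimal_centers_cong_mset by blast
  then have "infdist (?p i) (insert c ?Z) < 1/2"
  proof (rule almost_optimal_center_paired[OF nonempty, rotated 3])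
    fix t assume "t \<in> set ?T"
    then have "t \<noteq> i" by simp
    then show "dist (?p t) (?h t) = dist (?p t) (?p i) + dist (?h t) (?p i)"
      using median_partner_between[OF \<open>i < m\<close> _ long_prefix] by simp
    have "0 \<le> median_partner n m i t" "median_partner n m i t \<le> real n"
      by (simp_all add: median_partner_def)
    then show "dist (?p t) (?h t) \<le> infdist (?p t) ?Z" "dist (?p t) (?h t) \<le> infdist (?h t) ?Z"
      using far[of "code_pos m S t" n] far[of "median_partner n m i t" n]
        code_pos_nonneg[of m S t] code_pos_le[OF long_prefix, of S t] by auto
  qed
  then show "c \<in> ball (?p i) (1/2)"
    using far[OF code_pos_le[OF long_prefix], of S i] by (simp add: infdist_insert[OF nonempty])
qed

lemma kmedian_memory_bound:
  fixes A :: "('r, 'd::finite) streaming_alg" and m n :: nat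
  assumes "integer_points \<subseteq> X" "asymptotically_exact kmedian_cost k \<delta> X A"
    and "\<delta> < 1/2" "uses_memory A s" "2 \<le> k" and long_prefix: "4 * m + 1 \<le> n"
  shows "2 * (1/2 - \<delta>)\<^sup>2 * m \<le> real (s n) + 1"
proof (rule index_code_bound[OF assms(1) assms(2)[unfolded kmedian_cost_eq_stream_cost] assms(3,4) _
      \<open>2 \<le> k\<close> long_prefix,
      where query = "median_query n m" and anchors = "\<lambda>_. median_anchors n (k - 1)"])
  fix i assume "i < m"
  show "set (median_query n m i) \<subseteq> (integer_points :: (real ^ 'd) set)"
    by (auto simp: median_query_def median_partner_def intro!: axis_point_integer split: if_splits)
  show "set (median_anchors n (k - 1)) \<subseteq> (integer_points :: (real ^ 'd) set)"
    by (auto simp: median_anchors_def intro!: axis_point_integer)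
  show "card (set (median_anchors n (k - 1)) :: (real ^ 'd) set) + 1 = k"
    using \<open>2 \<le> k\<close> by (simp add: median_anchors_def card_image inj_on_def)
  show "set (median_anchors n (k - 1))
      \<inter> {axis_point 0, axis_point (code_pos m S i) :: real ^ 'd} = {}" for S
    using code_pos_le[OF long_prefix, of S i] by (auto simp: median_anchors_def)
  show "almost_optimal_centers 1 (set (median_anchors n (k - 1)))
        (index_code n m S @ median_query n m i) (1/2)
      \<subseteq> ball (axis_point (code_pos m S i) :: real ^ 'd) (1/2)" for S
    using \<open>i < m\<close> \<open>2 \<le> k\<close> long_prefix by (intro almost_optimal_centers_median_query) auto
  show "2 * (1/2) \<le> dist (axis_point (code_pos m S i) :: real ^ 'd) (axis_point (code_pos m S' i))"
    if "i \<in> S" "i \<notin> S'" for S S'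
    using that \<open>i < m\<close> by (simp add: code_pos_def)
qed simp_all

section \<open>The k-means query\<close>

text \<open>A quarter of the copies outweighs the other code points, whose cost is at most \<open>n ^ 3\<close>.\<close>

definition means_copies :: "nat \<Rightarrow> nat" where
  "means_copies n = 4 * n ^ 3 + 8"

definition means_slack :: "nat \<Rightarrow> real" where
  "means_slack n = 1 / (4 * real (Suc (means_copies n)))"

definition means_query :: "nat \<Rightarrow> nat \<Rightarrow> (real ^ 'd) list" where
  "means_query n i = replicate (means_copies n) (axis_point (slot i))"

definition means_anchors :: "nat \<Rightarrow> nat \<Rightarrow> (real ^ 'd) list" where
  "means_anchors r i =
     map (\<lambda>j. axis_point (slot i + (if j = 0 then - 2 else 2 + real j))) [0..<r]"

definition means_center :: "nat \<Rightarrow> nat set \<Rightarrow> nat \<Rightarrow> real ^ 'd" where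
  "means_center n S i = axis_point (slot i + of_bool (i \<in> S) / real (Suc (means_copies n)))"

lemma means_anchors_mem:
  assumes "2 \<le> r"
  shows "axis_point (slot i - 2) \<in> set (means_anchors r i)"
    "axis_point (slot i + 3) \<in> set (means_anchors r i)"
  using assms by (auto simp: means_anchors_def intro: image_eqI[of _ _ 0] image_eqI[of _ _ 1])

lemma infdist_means_anchors_ge:
  assumes "2 \<le> r" "0 \<le> x" "x \<le> 1"
  shows "2 \<le> infdist (axis_point (slot i + x) :: real ^ 'd::finite) (set (means_anchors r i))"
proof (rule le_infdist)
  show "set (means_anchors r i :: (real ^ 'd) list) \<noteq> {}" using assms(1)
    by (simp add: means_anchors_def)
qed (use assms in \<open>auto simp: means_anchors_def\<close>)

lemma infdist_means_anchors_le:
  fixes x :: "real ^ 'd::finite"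
  assumes "2 \<le> r" "i < m" and long_prefix: "4 * m + 1 \<le> n"
    and mem: "x \<in> set (code_points m S (remove1 i [0..<n]))"
  shows "infdist x (set (means_anchors r i)) \<le> real n"
    "infdist x (set (means_anchors r i)) + 1/2 \<le> dist x (axis_point (slot i))"
proof -
    obtain t where "t \<noteq> i" and point: "x = axis_point (code_pos m S t)" using mem
      by (auto simp: code_points_def)
  have upper: "infdist x (set (means_anchors r i)) \<le> \<bar>code_pos m S t - (slot i - 2)\<bar>"
      "infdist x (set (means_anchors r i)) \<le> \<bar>code_pos m S t - (slot i + 3)\<bar>"
    using infdist_le[OF means_anchors_mem(1)[OF assms(1)], of x i]
      infdist_le[OF means_anchors_mem(2)[OF assms(1)], of x i] by (simp_all add: point)
  have "0 \<le> slot i - 2" "slot i - 2 \<le> n" using \<open>i < m\<close> long_prefix by (simp_all add: slot_def)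
  then show "infdist x (set (means_anchors r i)) \<le> real n"
    using upper(1) code_pos_nonneg[of m S t] code_pos_le[OF long_prefix, of S t] by linarith
  have "code_pos m S t \<le> slot i - 3 \<or> slot i + 4 \<le> code_pos m S t"
    using \<open>t \<noteq> i\<close> \<open>i < m\<close> by (cases "t < i") (auto simp: code_pos_def slot_def)
  then show "infdist x (set (means_anchors r i)) + 1/2 \<le> dist x (axis_point (slot i))"
    using upper unfolding point dist_axis_point by linarith
qed

lemma power_cost_means_anchors_le:
  assumes "2 \<le> r" "i < m" "4 * m + 1 \<le> n"
  shows "power_cost 2 (code_points m S (remove1 i [0..<n]) :: (real ^ 'd::finite) list)
    (set (means_anchors r i)) \<le> real n ^ 3"
proof -
  let ?xs = "code_points m S (remove1 i [0..<n]) :: (real ^ 'd) list"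
  have "power_cost 2 ?xs (set (means_anchors r i)) \<le> real (length ?xs) * (real n)\<^sup>2"
    by (rule power_cost_le[OF infdist_means_anchors_le(1)[OF assms]])
  also have "\<dots> \<le> real n * (real n)\<^sup>2"
    by (intro mult_right_mono) (auto simp: code_points_def length_remove1)
  finally show ?thesis by (simp add: power3_eq_cube power2_eq_square)
qed

lemma means_center_centroid:
  assumes "i < m"
  shows "real (Suc (means_copies n)) *\<^sub>R (means_center n S i :: real ^ 'd::finite)
    = sum_list (axis_point (code_pos m S i) # means_query n i)"
proof -
  have "sum_list (replicate w v) = real w *\<^sub>R v" for w and v :: "real ^ 'd"
    by (induction w) (auto simp: scaleR_left_distrib)
  moreover have "real (Suc (means_copies n)) * (slot i + of_bool (i \<in> S) / real (Suc (means_copies n)))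
      = code_pos m S i + real (means_copies n) * (slot i)"
    using assms
    by (simp add: code_pos_def slot_def field_simps del: of_nat_Suc) (simp add: algebra_simps)
  ultimately show ?thesis
    by (simp only: means_center_def means_query_def axis_point_def sum_list.Cons
        scaleR_scaleR scaleR_left_distrib[symmetric])
qed

lemma almost_optimal_centers_means_query:
  assumes "i < m" "2 \<le> r" and long_prefix: "4 * m + 1 \<le> n"
  shows "almost_optimal_centers 2 (set (means_anchors r i))
      (index_code n m S @ means_query n i) (means_slack n)
    \<subseteq> ball (means_center n S i :: real ^ 'd::finite) (2 * means_slack n)"
proof
  fix c :: "real ^ 'd"
  assume almost_optimal: "c \<in> almost_optimal_centers 2 (set (means_anchors r i))
    (index_code n m S @ means_query n i) (means_slack n)"
  let ?Z = "set (means_anchors r i) :: (real ^ 'd) set"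
  let ?p = "axis_point (code_pos m S i) :: real ^ 'd"
  let ?b = "axis_point (slot i) :: real ^ 'd"
  let ?xs = "code_points m S (remove1 i [0..<n]) :: (real ^ 'd) list"
  define w where "w = means_copies n"
  have bit_point: "dist ?p ?b \<le> 1" "2 \<le> infdist ?p ?Z"
    using infdist_means_anchors_ge[OF \<open>2 \<le> r\<close>, of "of_bool (i \<in> S)" i, where 'd = 'd] \<open>i < m\<close>
    by (simp_all add: code_pos_def slot_def)
  have slack: "0 < means_slack n" "means_slack n \<le> 1" by (simp_all add: means_slack_def)
  have "mset (index_code n m S @ means_query n i) = mset (?xs @ [?p] @ replicate w ?b)"
    using mset_index_code[of i n m S] \<open>i < m\<close> long_prefix by (simp add: means_query_def w_def)
  then have "c \<in> almost_optimal_centers 2 ?Z (?xs @ [?p] @ replicate w ?b) (means_slack n)"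
    using almost_optimal almost_optimal_centers_cong_mset by blast
  then have "real (length [?p] + w) * (dist (means_center n S i) c)\<^sup>2 < means_slack n"
  proof (rule almost_optimal_center_centroid[where r = "1/2", rotated -1])
    show "?Z \<noteq> {}" using \<open>2 \<le> r\<close> by (simp add: means_anchors_def)
    show "infdist x ?Z + 1/2 \<le> dist x ?b" if "x \<in> set ?xs" for x
      by (rule infdist_means_anchors_le(2)[OF \<open>2 \<le> r\<close> \<open>i < m\<close> long_prefix that])
    show "dist y ?b + 1/2 \<le> infdist y ?Z" if "y \<in> set [?p]" for y
      using that bit_point by simp
    show "1/2 \<le> infdist ?b ?Z"
      using infdist_means_anchors_ge[OF \<open>2 \<le> r\<close>, of 0 i, where 'd = 'd] by simp
    show "power_cost 2 ?xs ?Z + power_cost 2 [?p] {?b} + means_slack n \<le> real w * (1/2)\<^sup>2"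
      using power_cost_means_anchors_le[OF \<open>2 \<le> r\<close> \<open>i < m\<close> long_prefix, of S, where 'd = 'd]
        power_le_one[OF zero_le_dist bit_point(1), of 2] slack(2)
      by (simp add: w_def means_copies_def power2_eq_square)
    show "real (length [?p] + w) *\<^sub>R means_center n S i = sum_list ([?p] @ replicate w ?b)"
      using means_center_centroid[OF \<open>i < m\<close>, of n S, where 'd = 'd]
      by (simp add: means_query_def w_def)
  qed simp
  also have "means_slack n = real (length [?p] + w) * (2 * means_slack n)\<^sup>2"
    by (simp add: means_slack_def w_def power2_eq_square divide_simps del: of_nat_Suc)
  finally have "(dist (means_center n S i) c)\<^sup>2 < (2 * means_slack n)\<^sup>2"
    by (simp add: mult_less_cancel_left del: of_nat_Suc)
  then show "c \<in> ball (means_center n S i) (2 * means_slack n)"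
    using power_less_imp_less_base slack(1) by fastforce
qed

lemma kmeans_memory_bound:
  fixes A :: "('r, 'd::finite) streaming_alg" and m n :: nat
  assumes "integer_points \<subseteq> X" "asymptotically_exact kmeans_cost k \<delta> X A"
    and "\<delta> < 1/2" "uses_memory A s" "3 \<le> k" and long_prefix: "4 * m + 1 \<le> n"
  shows "2 * (1/2 - \<delta>)\<^sup>2 * m \<le> real (s n) + 1"
proof (rule index_code_bound[OF assms(1) assms(2)[unfolded kmeans_cost_eq_stream_cost] assms(3,4)
      _ _ long_prefix,
      where query = "means_query n" and anchors = "means_anchors (k - 1)"])
  have "2 \<le> k - 1" using \<open>3 \<le> k\<close> by simp
  fix i assume "i < m"
  show "set (means_query n i) \<subseteq> (integer_points :: (real ^ 'd) set)"
    by (auto simp: means_query_def slot_def intro!: axis_point_integer)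
  show "set (means_anchors (k - 1) i) \<subseteq> (integer_points :: (real ^ 'd) set)"
    by (auto simp: means_anchors_def slot_def intro!: axis_point_integer)
  show "card (set (means_anchors (k - 1) i) :: (real ^ 'd) set) + 1 = k"
    using \<open>3 \<le> k\<close> by (simp add: means_anchors_def card_image inj_on_def)
  show "set (means_anchors (k - 1) i)
      \<inter> {axis_point 0, axis_point (code_pos m S i) :: real ^ 'd} = {}" for S
    using \<open>i < m\<close> by (auto simp: means_anchors_def code_pos_def slot_def split: if_splits)
  show "almost_optimal_centers 2 (set (means_anchors (k - 1) i))
        (index_code n m S @ means_query n i) (means_slack n)
      \<subseteq> ball (means_center n S i :: real ^ 'd) (2 * means_slack n)" for S
    by (rule almost_optimal_centers_means_query[OF \<open>i < m\<close> \<open>2 \<le> k - 1\<close> long_prefix])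
  show "2 * (2 * means_slack n)
      \<le> dist (means_center n S i :: real ^ 'd) (means_center n S' i)" if "i \<in> S" "i \<notin> S'" for S S'
    using that by (simp add: means_center_def means_slack_def del: of_nat_Suc)
qed (use \<open>3 \<le> k\<close> in \<open>simp_all add: means_slack_def\<close>)

section \<open>The lower bound\<close>

lemma bigomega_of_linear_lower_bound:
  fixes f :: "nat \<Rightarrow> real" and c :: real
  assumes "0 < c" and bound: "\<And>m n :: nat. 4 * m + 1 \<le> n \<Longrightarrow> c * m \<le> f n + 1"
  shows "f \<in> \<Omega>(\<lambda>n. real n)"
proof -
  have "c / 8 * real n \<le> f n" if large_n: "(1 + c) / (c / 8) \<le> real n" for n
  proof -
    have large: "1 + c \<le> c / 8 * real n"
      using large_n \<open>0 < c\<close> by (simp add: pos_divide_le_eq mult.commute)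
    then have "n \<noteq> 0" using \<open>0 < c\<close> by (intro notI) simp
    then have "4 * ((n - 1) div 4) + 1 \<le> n" by linarith
    then have "c * real ((n - 1) div 4) \<le> f n + 1" by (rule bound)
    moreover have "n \<le> 4 * ((n - 1) div 4) + 4" by linarith
    then have "c / 4 * real n \<le> c / 4 * (4 * real ((n - 1) div 4) + 4)"
      using \<open>0 < c\<close> by (intro mult_left_mono) linarith+
    ultimately show ?thesis using large by (simp add: algebra_simps)
  qed
  then have "\<forall>\<^sub>F n in sequentially. c / 8 * real n \<le> f n"
    by (intro eventually_sequentiallyI[of "nat \<lceil>(1 + c) / (c / 8)\<rceil>"]) (simp add: nat_ceiling_le_eq)
  then show ?thesis
    using \<open>0 < c\<close> by (intro landau_omega.bigI[of "c / 8"]) (auto elim: eventually_mono)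
qed

theorem theorem10:
  fixes A :: "('r, 'd::finite) streaming_alg"
    and X :: "(real ^ 'd) set"
    and k :: nat and \<delta> :: real and s :: "nat \<Rightarrow> nat"
  assumes "integer_points \<subseteq> X"
    and "\<delta> < 1 / 2"
    and "(k \<ge> 2 \<and> asymptotically_exact kmedian_cost k \<delta> X A) \<or>
         (k \<ge> 3 \<and> asymptotically_exact kmeans_cost k \<delta> X A)"
    and "uses_memory A s"
  shows "(\<lambda>n. real (s n)) \<in> \<Omega>(\<lambda>n. real n)"
proof (rule bigomega_of_linear_lower_bound)
  show "0 < 2 * (1/2 - \<delta>)\<^sup>2" using assms(2) by simp
  show "2 * (1/2 - \<delta>)\<^sup>2 * real m \<le> real (s n) + 1" if "4 * m + 1 \<le> n" for m n
    using assms(3) kmedian_memory_bound[OF assms(1) _ assms(2,4) _ that]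
      kmeans_memory_bound[OF assms(1) _ assms(2,4) _ that] by blast
qed

end
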